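(* Let $f:\mathbb{C}\to\mathbb{C}$ be a holomorphic function, and let $W:\mathbb{R}^2\to[0,\infty)$ be defined by $W(z)=|f(z)|^2$ (identifying $\mathbb{R}^2$ with $\mathbb{C}$). Let $a^-\neq a^+$ be two nondegenerate zeros of $W$, and let $e\in C^2(\mathbb{R};\mathbb{R}^2)$ be a heteroclinic orbit connecting $a^-$ and $a^+$. Then $e$ is nondegenerate, i.e. the operator $L:H^2(\mathbb{R};\mathbb{R}^2)\to L^2(\mathbb{R};\mathbb{R}^2)$, $Lh=-h''+D^2W(e)h$, is nonnegative ($\langle Lh,h\rangle_{L^2}\ge 0$ for all $h\in H^2(\mathbb{R};\mathbb{R}^2)$) and $\dim\ker L=1$ (so that $\ker L=\{\lambda e':\lambda\in\mathbb{R}\}$). The heteroclinic orbit $e$ is not assumed to be a minimizer of the energy.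
   Context: We identify $\mathbb{R}^2$ with $\mathbb{C}$ via $(u_1,u_2)\mapsto u_1+iu_2$. A zero $a$ of $W$ is called nondegenerate if the Hessian matrix $D^2W(a)$ is positive definite. A heteroclinic orbit connecting $a^-$ and $a^+$ is a solution $e\in C^2(\mathbb{R};\mathbb{R}^2)$ of $e''(x)=\nabla W(e(x))$ for all $x\in\mathbb{R}$, with $\lim_{x\to-\infty}e(x)=a^-$ and $\lim_{x\to+\infty}e(x)=a^+$, where $a^-\ne a^+$ are zeros of $W$. The energy is $E(u)=\int_{\mathbb{R}}\big[\tfrac12|u'|^2+W(u)\big]\,dx$ for $u\in H^1_{\mathrm{loc}}(\mathbb{R};\mathbb{R}^2)$. *)

theory Defs
  imports "HOL-Analysis.Analysis"
begin

text \<open>We identify R^2 with the type complex (a real inner product space).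
  Gradient of W at x: the vector g with W'(x) h = g \<bullet> h.\<close>
definition grad :: "(complex \<Rightarrow> real) \<Rightarrow> complex \<Rightarrow> complex" where
  "grad W x = (THE g. (W has_derivative (\<lambda>h. g \<bullet> h)) (at x))"

definition hess :: "(complex \<Rightarrow> real) \<Rightarrow> complex \<Rightarrow> complex \<Rightarrow> complex" where
  "hess W x = (THE H. (grad W has_derivative H) (at x))"

definition nondeg_zero :: "(complex \<Rightarrow> real) \<Rightarrow> complex \<Rightarrow> bool" where
  "nondeg_zero W a \<longleftrightarrow> W a = 0 \<and> (\<forall>v. v \<noteq> 0 \<longrightarrow> hess W a v \<bullet> v > 0)"

definition L2 :: "(real \<Rightarrow> complex) \<Rightarrow> bool" where
  "L2 h \<longleftrightarrow> h \<in> borel_measurable lborel \<and> integrable lborel (\<lambda>x. (norm (h x))\<^sup>2)"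

text \<open>h \<in> H^2(R;R^2), represented by its (unique) C^1 representative h, with
  derivative h1 and weak second derivative h2 (h1 absolutely continuous, h1' = h2 a.e.).\<close>
definition H2_with :: "(real \<Rightarrow> complex) \<Rightarrow> (real \<Rightarrow> complex) \<Rightarrow> (real \<Rightarrow> complex) \<Rightarrow> bool" where
  "H2_with h h1 h2 \<longleftrightarrow>
     (\<forall>x. (h has_vector_derivative h1 x) (at x)) \<and>
     (\<forall>a b. a \<le> b \<longrightarrow> (h2 has_integral (h1 b - h1 a)) {a..b}) \<and>
     L2 h \<and> L2 h1 \<and> L2 h2"

definition kerL :: "(complex \<Rightarrow> real) \<Rightarrow> (real \<Rightarrow> complex) \<Rightarrow> (real \<Rightarrow> complex) set" where
  "kerL W e = {h. \<exists>h1 h2. H2_with h h1 h2 \<and>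
                   (AE x in lborel. - h2 x + hess W (e x) (h x) = 0)}"

end

theory Submission
  imports Defs "HOL-Complex_Analysis.Cauchy_Integral_Formula"
begin

text \<open>Equipartition of energy and the Cauchy--Riemann equations reduce the second-order equation to
  $e' = \overline{g(e)}$ with $g = c f$ and $|c|^2 = 2$. With $A = g'(e)$ and $D h = h' - \overline{A h}$
  the linearized operator factors as $L = D^* D$, so $\langle Lh, h\rangle = \|Dh\|^2 \ge 0$, and
  $Lh = 0$ forces $Dh = 0$. The real-linear map $h \mapsto \overline{A h}$ has trace zero, so
  $\mathrm{Im}(\overline{e'} h)$ is constant for such $h$. Both functions lie in $L^2$, so the
  constant is $0$, and $h$ is a real multiple of $e'$.\<close>

text \<open>The factorization rests on a symmetry: \<open>h \<mapsto> cnj (A * h)\<close> is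
  self-adjoint for the real inner product, so the adjoint of D sends k to
  \<open>- k' - cnj (A * k)\<close>. In the product the terms containing \<open>h'\<close> cancel
  and \<open>- h'' + cnj A * A * h + cnj (A' * h)\<close> remains. The value |c|^2 = 2 is forced by
  |e'|^2 = 2 W(e), and it is also the factor 2 in the Hessian of |f|^2. The obstacles are regularity
  and decay. The second derivative of h exists only as an integrand, so the product rule for h' and
  h is proved in integrated form. Functions in L^2 come without limits at infinity, so boundary
  terms are removed along endpoints chosen where an integrable function happens to be small. That e'
  lies in L^2 follows from a gradient structure: conj(g) is the gradient of Re G for a primitive G
  of g.\<close>

section \<open>Uniqueness for linear differential inequalities; integration by parts with weak
  derivatives\<close>

text \<open>The squared norm n satisfies |n'| \<le> 2 K n, so
  \<open>n t * exp (- (2 * K * t))\<close> is nonincreasing and \<open>n t * exp (2 * K * t)\<close>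
  is nondecreasing. The first carries the zero at \<open>x0\<close> forwards, the second
  backwards.\<close>

lemma gronwall_vanish:
  fixes u u' :: "real \<Rightarrow> 'a::real_inner"
  assumes du: "\<And>x. (u has_vector_derivative u' x) (at x)"
    and le: "\<And>x. norm (u' x) \<le> K * norm (u x)"
    and z: "u x0 = 0"
  shows "u x = 0"
proof -
  define n where "n x = u x \<bullet> u x" for x
  have dn: "(n has_real_derivative 2 * (u x \<bullet> u' x)) (at x)" for x
    unfolding n_def has_field_derivative_def
    by (rule derivative_eq_intros du[unfolded has_vector_derivative_def] refl)+
       (simp add: inner_commute fun_eq_iff)
  have nb: "\<bar>2 * (u x \<bullet> u' x)\<bar> \<le> 2 * K * n x" for x
  proof -
    have "\<bar>u x \<bullet> u' x\<bar> \<le> norm (u x) * norm (u' x)" by (rule Cauchy_Schwarz_ineq2)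
    also have "\<dots> \<le> norm (u x) * (K * norm (u x))" by (intro mult_left_mono le) auto
    also have "\<dots> = K * n x" by (simp add: n_def power2_norm_eq_inner[symmetric] power2_eq_square)
    finally show ?thesis by simp
  qed
  have n0: "n x0 = 0" using z by (simp add: n_def)
  have "n x \<le> 0"
  proof (cases "x0 \<le> x")
    case True
    have d: "((\<lambda>t. n t * exp (- (2 * K * t))) has_real_derivative
        2 * (u t \<bullet> u' t) * exp (- (2 * K * t)) + n t * (exp (- (2 * K * t)) * (- (2 * K)))) (at t)" for t
      by (rule derivative_eq_intros dn refl | simp)+
    have "n x * exp (- (2 * K * x)) \<le> n x0 * exp (- (2 * K * x0))"
    proof (rule DERIV_nonpos_imp_nonincreasing[OF True])
      fix t
      have "2 * (u t \<bullet> u' t) * exp (- (2 * K * t)) + n t * (exp (- (2 * K * t)) * (- (2 * K)))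
          = (2 * (u t \<bullet> u' t) - 2 * K * n t) * exp (- (2 * K * t))" by (simp add: algebra_simps)
      also have "\<dots> \<le> 0" using nb[of t] by (intro mult_nonpos_nonneg) auto
      finally show "\<exists>y. ((\<lambda>t. n t * exp (- (2 * K * t))) has_real_derivative y) (at t) \<and> y \<le> 0"
        using d[of t] by blast
    qed
    then show ?thesis by (simp add: n0 mult_le_0_iff not_le)
  next
    case False
    then have x: "x \<le> x0" by simp
    have d: "((\<lambda>t. n t * exp (2 * K * t)) has_real_derivative
        2 * (u t \<bullet> u' t) * exp (2 * K * t) + n t * (exp (2 * K * t) * (2 * K))) (at t)" for t
      by (rule derivative_eq_intros dn refl | simp)+
    have "n x * exp (2 * K * x) \<le> n x0 * exp (2 * K * x0)"
    proof (rule DERIV_nonneg_imp_nondecreasing[OF x])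
      fix t
      have "2 * (u t \<bullet> u' t) * exp (2 * K * t) + n t * (exp (2 * K * t) * (2 * K))
          = (2 * (u t \<bullet> u' t) + 2 * K * n t) * exp (2 * K * t)" by (simp add: algebra_simps)
      also have "\<dots> \<ge> 0" using nb[of t] by (intro mult_nonneg_nonneg) auto
      finally show "\<exists>y. ((\<lambda>t. n t * exp (2 * K * t)) has_real_derivative y) (at t) \<and> 0 \<le> y"
        using d[of t] by blast
    qed
    then show ?thesis by (simp add: n0 mult_le_0_iff not_le)
  qed
  then show ?thesis by (simp add: n_def dot_square_norm)
qed

lemma isCont_if_indefinite_integral:
  fixes u u' :: "real \<Rightarrow> 'a::euclidean_space"
  assumes "\<And>a b. a \<le> b \<Longrightarrow> (u' has_integral (u b - u a)) {a..b}"
  shows "isCont u x"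
proof -
  have "continuous_on {x-1..x+1} (\<lambda>y. u (x - 1) + integral {x-1..y} u')"
    using assms[of "x-1" "x+1"] by (intro continuous_intros indefinite_integral_continuous_1) auto
  moreover have "u (x - 1) + integral {x-1..y} u' = u y" if "y \<in> {x-1..x+1}" for y
    using integral_unique[OF assms[of "x-1" y]] that by simp
  ultimately have "continuous_on {x-1..x+1} u"
    by (rule continuous_on_eq)
  then have "continuous_on {x-1<..<x+1} u" by (rule continuous_on_subset) auto
  then show ?thesis by (simp add: continuous_on_eq_continuous_at)
qed

text \<open>This is meant for \<open>u = h1\<close> and \<open>u' = h2\<close> in
  \<open>H2_with\<close>, where \<open>u\<close> is known only through the integrals of
  \<open>u'\<close>. Absolute integrability of \<open>u'\<close> makes \<open>u' \<bullet> h\<close>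
  integrable and lets \<open>norm (u' t)\<close> enter the error bound.\<close>

lemma integration_by_parts_indefinite:
  fixes u u' h h' :: "real \<Rightarrow> 'a::euclidean_space"
  assumes ab: "a \<le> b"
    and u: "\<And>a b. a \<le> b \<Longrightarrow> (u' has_integral (u b - u a)) {a..b}"
    and u'_abs: "\<And>a b. u' absolutely_integrable_on {a..b}"
    and dh: "\<And>x. (h has_vector_derivative h' x) (at x)"
    and ch': "continuous_on UNIV h'"
  shows "((\<lambda>t. u' t \<bullet> h t + u t \<bullet> h' t) has_integral (u b \<bullet> h b - u a \<bullet> h a)) {a..b}"
proof -
  have cu: "isCont u x" for x by (rule isCont_if_indefinite_integral[OF u])
  have ch: "isCont h x" for x using dh[of x] by (rule has_vector_derivative_continuous)
  have cu_on: "continuous_on S u" and ch_on: "continuous_on S h" and ch'_on: "continuous_on S h'" for S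
    using cu ch by (auto intro: continuous_at_imp_continuous_on continuous_on_subset[OF ch'])
  have h: "(h' has_integral (h b - h a)) {a..b}" if "a \<le> b" for a b
    using that by (intro fundamental_theorem_of_calculus) (auto intro: has_vector_derivative_at_within dh)
  define q where "q t = u' t \<bullet> h t + u t \<bullet> h' t" for t
  define m where "m t = norm (u' t) + norm (h' t)" for t
  have i1: "(\<lambda>t. u' t \<bullet> h t) integrable_on {a..b}" for a b
  proof -
    have "bilinear ((\<bullet>) :: 'a \<Rightarrow> 'a \<Rightarrow> real)"
      by (simp add: bilinear_conv_bounded_bilinear bounded_bilinear_inner)
    then have "(\<lambda>t. h t \<bullet> u' t) absolutely_integrable_on {a..b}"
      by (rule absolutely_integrable_bounded_measurable_product)
         (auto intro!: u'_abs compact_imp_bounded compact_continuous_image ch_on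
           continuous_imp_measurable_on_sets_lebesgue)
    then show ?thesis by (simp add: inner_commute absolutely_integrable_on_def)
  qed
  have iq: "q integrable_on {a..b}" for a b
    unfolding q_def
    by (intro integrable_add i1 integrable_continuous_interval continuous_intros cu_on ch'_on)
  have im: "m integrable_on {a..b}" for a b
    unfolding m_def using u'_abs[of a b] ch'_on[of "{a..b}"]
    by (intro integrable_add integrable_continuous_interval[where f = "\<lambda>t. norm (h' t)"] continuous_on_norm)
       (auto simp: absolutely_integrable_on_def)
  txt \<open>Since $u$ need not be differentiable, the increment of $u \<bullet> h$ is compared with the integral on short
    intervals, where the error is at most $\<epsilon>$ times an additive interval function.\<close>
  have est: "norm (u b \<bullet> h b - u a \<bullet> h a - integral {a..b} q) \<le> \<epsilon> * integral {a..b} m"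
    if "\<epsilon> > 0" for \<epsilon>
    using ab
  proof (induct rule: Bolzano)
    case (trans a b c)
    have "integral {a..c} q = integral {a..b} q + integral {b..c} q"
      "integral {a..c} m = integral {a..b} m + integral {b..c} m"
      using trans by (simp_all add: Henstock_Kurzweil_Integration.integral_combine iq im)
    then show ?case using trans(1,2) by (simp add: abs_le_iff ring_distribs)
  next
    case (local x)
    obtain d1 where d1: "d1 > 0" "\<And>s. \<bar>s - x\<bar> < d1 \<Longrightarrow> norm (u s - u x) < \<epsilon> / 2"
      using cu[of x] \<open>\<epsilon> > 0\<close> unfolding continuous_at_eps_delta dist_norm
      by (metis half_gt_zero real_norm_def)
    obtain d2 where d2: "d2 > 0" "\<And>s. \<bar>s - x\<bar> < d2 \<Longrightarrow> norm (h s - h x) < \<epsilon> / 2"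
      using ch[of x] \<open>\<epsilon> > 0\<close> unfolding continuous_at_eps_delta dist_norm
      by (metis half_gt_zero real_norm_def)
    have "norm (u w \<bullet> h w - u v \<bullet> h v - integral {v..w} q) \<le> \<epsilon> * integral {v..w} m"
      if vw: "v \<le> x" "x \<le> w" "w - v < min d1 d2" for v w
    proof -
      \<comment> \<open>Freezing \<open>h\<close> at the left end and \<open>u\<close> at the right
        end makes this splitting exact, so the whole error comes from replacing \<open>h t\<close>
        by \<open>h v\<close> and \<open>u t\<close> by \<open>u w\<close> in the integrand.\<close>
      have "u w \<bullet> h w - u v \<bullet> h v = (u w - u v) \<bullet> h v + u w \<bullet> (h w - h v)"
        by (simp add: algebra_simps)
      moreover have "((\<lambda>t. u' t \<bullet> h v + u w \<bullet> h' t - q t) has_integral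
           ((u w - u v) \<bullet> h v + u w \<bullet> (h w - h v) - integral {v..w} q)) {v..w}"
        using vw has_integral_linear[OF u bounded_linear_inner_left, of v w "h v"]
          has_integral_linear[OF h bounded_linear_inner_right, of v w "u w"] iq[of v w]
        by (intro has_integral_diff has_integral_add) (auto simp: o_def has_integral_integral)
      ultimately have r: "((\<lambda>t. u' t \<bullet> h v + u w \<bullet> h' t - q t) has_integral
           (u w \<bullet> h w - u v \<bullet> h v - integral {v..w} q)) {v..w}" by simp
      have "norm (integral {v..w} (\<lambda>t. u' t \<bullet> h v + u w \<bullet> h' t - q t)) \<le> integral {v..w} (\<lambda>t. \<epsilon> * m t)"
      proof (rule Henstock_Kurzweil_Integration.integral_norm_bound_integral)
        show "(\<lambda>t. u' t \<bullet> h v + u w \<bullet> h' t - q t) integrable_on {v..w}" using r by blast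
        show "(\<lambda>t. \<epsilon> * m t) integrable_on {v..w}" using integrable_on_cmult_left[OF im, of \<epsilon>] by simp
        fix t assume t: "t \<in> {v..w}"
        have nn: "norm (h v - h t) \<le> \<epsilon>" "norm (u w - u t) \<le> \<epsilon>"
        proof -
          have "norm (u w - u x) < \<epsilon> / 2" "norm (u t - u x) < \<epsilon> / 2"
            by (rule d1(2), use t vw in force)+
          moreover have "norm (h v - h x) < \<epsilon> / 2" "norm (h t - h x) < \<epsilon> / 2"
            by (rule d2(2), use t vw in force)+
          ultimately show "norm (h v - h t) \<le> \<epsilon>" "norm (u w - u t) \<le> \<epsilon>"
            using norm_triangle_ineq4[of "h v - h x" "h t - h x"]
              norm_triangle_ineq4[of "u w - u x" "u t - u x"] by simp_all
        qed
        have "u' t \<bullet> h v + u w \<bullet> h' t - q t = u' t \<bullet> (h v - h t) + (u w - u t) \<bullet> h' t"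
          by (simp add: q_def algebra_simps)
        also have "norm \<dots> \<le> norm (u' t) * norm (h v - h t) + norm (u w - u t) * norm (h' t)"
          by (smt (verit) Cauchy_Schwarz_ineq2 real_norm_def)
        also have "\<dots> \<le> norm (u' t) * \<epsilon> + \<epsilon> * norm (h' t)"
          by (intro add_mono mult_left_mono mult_right_mono nn) auto
        finally show "norm (u' t \<bullet> h v + u w \<bullet> h' t - q t) \<le> \<epsilon> * m t"
          by (simp add: m_def algebra_simps)
      qed
      with r show ?thesis by (simp add: integral_unique)
    qed
    then show ?case using d1(1) d2(1) by (intro exI[of _ "min d1 d2"]) auto
  qed
  have m0: "integral {a..b} m \<ge> 0" by (rule integral_nonneg[OF im]) (simp add: m_def)
  have "norm (u b \<bullet> h b - u a \<bullet> h a - integral {a..b} q) \<le> 0 + \<delta>" if "\<delta> > 0" for \<delta>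
  proof -
    \<comment> \<open>The summand 1 keeps the denominator positive even if the integral of
      \<open>m\<close> is 0.\<close>
    have "norm (u b \<bullet> h b - u a \<bullet> h a - integral {a..b} q) \<le> \<delta> / (integral {a..b} m + 1) * integral {a..b} m"
      using m0 that by (intro est) simp
    also have "\<dots> \<le> \<delta>" using m0 that by (simp add: field_simps)
    finally show ?thesis by simp
  qed
  then have "norm (u b \<bullet> h b - u a \<bullet> h a - integral {a..b} q) \<le> 0" by (rule field_le_epsilon)
  then have "integral {a..b} q = u b \<bullet> h b - u a \<bullet> h a" by simp
  then show ?thesis using iq[of a b] unfolding q_def by (metis has_integral_integral)
qed

section \<open>Boundary terms at infinity and almost-everywhere vanishing\<close>

text \<open>Otherwise the integral of |B| would be at least \<open>\<delta>\<close> times an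
  infinite measure. This replaces a limit of \<open>B\<close> at infinity, and it also shows that an
  integrable constant is 0.\<close>

lemma integrable_lborel_small_value:
  fixes B :: "real \<Rightarrow> real"
  assumes B: "integrable lborel B" and S: "S \<in> sets borel" "emeasure lborel S = \<infinity>" and "\<delta> > 0"
  obtains x where "x \<in> S" "\<bar>B x\<bar> < \<delta>"
proof -
  have "\<exists>x\<in>S. \<bar>B x\<bar> < \<delta>"
  proof (rule ccontr)
    assume "\<not> ?thesis"
    then have ge: "\<delta> \<le> \<bar>B x\<bar>" if "x \<in> S" for x using that by force
    have "(\<infinity>::ennreal) = ennreal \<delta> * emeasure lborel S"
      using S \<open>\<delta> > 0\<close> by (simp add: ennreal_mult_top)
    also have "\<dots> = (\<integral>\<^sup>+x. ennreal \<delta> * indicator S x \<partial>lborel)"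
      using S by (simp add: nn_integral_cmult_indicator)
    also have "\<dots> \<le> (\<integral>\<^sup>+x. ennreal (norm (B x)) \<partial>lborel)"
      by (intro nn_integral_mono) (auto simp: ge ennreal_leI split: split_indicator)
    also have "\<dots> < \<infinity>" using B by (simp add: integrable_iff_bounded)
    finally show False by simp
  qed
  then show thesis using that by blast
qed

lemma emeasure_lborel_atLeast: "emeasure lborel {R::real..} = \<infinity>"
  and emeasure_lborel_atMost: "emeasure lborel {..R::real} = \<infinity>"
proof -
  have "emeasure lborel {R..} \<ge> ennreal (real n)" for n
    using emeasure_mono[of "{R..R + real n}" "{R..}" lborel] by auto
  then show "emeasure lborel {R..} = \<infinity>"
    by (metis ennreal_of_nat_eq_real_of_nat infinity_ennreal_def ennreal_Ex_less_of_nat not_le top.not_eq_extremum)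
  have "emeasure lborel {..R} \<ge> ennreal (real n)" for n
    using emeasure_mono[of "{R - real n..R}" "{..R}" lborel] by auto
  then show "emeasure lborel {..R} = \<infinity>"
    by (metis ennreal_of_nat_eq_real_of_nat infinity_ennreal_def ennreal_Ex_less_of_nat not_le top.not_eq_extremum)
qed

text \<open>No convergence of \<open>B\<close> at infinity is required: arbitrarily far out on both
  sides there are endpoints where \<open>B\<close> is small, and the integral of \<open>q\<close>
  between them is close to the full one.\<close>

lemma integral_derivative_of_integrable:
  fixes B q :: "real \<Rightarrow> real"
  assumes B: "integrable lborel B" and q: "integrable lborel q"
    and Bq: "\<And>a b. a \<le> b \<Longrightarrow> (q has_integral (B b - B a)) {a..b}"
  shows "(LINT x|lborel. q x) = 0"
proof -
  define I where "I = (LINT x|lborel. q x)"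
  have "(q has_integral I) UNIV"
    unfolding I_def using q by (rule has_integral_integral_lborel)
  \<comment> \<open>The line is not a box, so unfolding the integral gives its exhaustion form: over
    every interval containing a large ball, the integral of \<open>q\<close> is within
    \<open>\<epsilon>\<close> of \<open>I\<close>.\<close>
  moreover have "\<nexists>a b. (UNIV :: real set) = cbox a b" by (metis bounded_cbox not_bounded_UNIV)
  ultimately have lim: "\<exists>R>0. \<forall>a b. ball 0 R \<subseteq> {a..b} \<longrightarrow>
      (\<exists>z. (q has_integral z) {a..b} \<and> norm (z - I) < \<epsilon>)" if "\<epsilon> > 0" for \<epsilon>
    using that has_integral_alt[of q I UNIV] by simp
  have "\<bar>I\<bar> \<le> 0 + \<delta>" if "\<delta> > 0" for \<delta>
  proof -
    from that have "\<delta> / 3 > 0" by simp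
    from lim[OF this] obtain R where R: "R > 0"
      "\<And>a b. ball 0 R \<subseteq> {a..b} \<Longrightarrow> \<exists>z. (q has_integral z) {a..b} \<and> norm (z - I) < \<delta> / 3" by blast
    obtain b where b: "b \<ge> R" "\<bar>B b\<bar> < \<delta> / 3"
      using integrable_lborel_small_value[OF B _ emeasure_lborel_atLeast \<open>\<delta> / 3 > 0\<close>, of R] by auto
    obtain a where a: "a \<le> - R" "\<bar>B a\<bar> < \<delta> / 3"
      using integrable_lborel_small_value[OF B _ emeasure_lborel_atMost \<open>\<delta> / 3 > 0\<close>, of "-R"] by auto
    have "ball 0 R \<subseteq> {a..b}" using a b by (auto simp: dist_real_def)
    then obtain z where z: "(q has_integral z) {a..b}" "norm (z - I) < \<delta> / 3" using R by blast
    have "z = B b - B a" using z(1) Bq[of a b] a b R(1) by (auto intro: has_integral_unique)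
    then show ?thesis using z(2) a b by (auto simp: abs_if split: if_splits)
  qed
  then have "\<bar>I\<bar> \<le> 0" by (rule field_le_epsilon)
  then show ?thesis by (simp add: I_def)
qed

text \<open>The set where \<open>u\<close> is nonzero is open and null, hence empty.\<close>

lemma AE_lborel_continuous_eq_0:
  fixes u :: "real \<Rightarrow> 'a::real_normed_vector"
  assumes "AE x in lborel. u x = 0" "continuous_on UNIV u"
  shows "u x = 0"
proof -
  have "open {x. u x \<noteq> 0}"
    using assms(2) by (intro open_Collect_neq) auto
  moreover have "negligible {x. u x \<noteq> 0}"
    using AE_completion[OF assms(1)] by (simp add: negligible_iff_null_sets AE_iff_null_sets
        completion.AE_iff_null_sets eventually_ae_filter) (metis (no_types, lifting) completion.complete2)
  ultimately show ?thesis using open_not_negligible by blast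
qed

section \<open>Square-integrable functions on the line\<close>

lemma L2_dominated:
  assumes "L2 v" "u \<in> borel_measurable lborel" "\<And>x. norm (u x) \<le> C * norm (v x)"
  shows "L2 u"
proof -
  have "integrable lborel (\<lambda>x. C\<^sup>2 * (norm (v x))\<^sup>2)"
    using assms(1) by (intro integrable_mult_right) (auto simp: L2_def)
  then have "integrable lborel (\<lambda>x. (norm (u x))\<^sup>2)"
  proof (rule Bochner_Integration.integrable_bound[OF _ _ AE_I2])
    show "(\<lambda>x. (norm (u x))\<^sup>2) \<in> borel_measurable lborel"
      using assms(2) by measurable
    show "norm ((norm (u x))\<^sup>2) \<le> norm (C\<^sup>2 * (norm (v x))\<^sup>2)" for x
      using power_mono[OF assms(3) norm_ge_zero, of x 2] by (simp add: power_mult_distrib)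
  qed
  with assms(2) show ?thesis by (simp add: L2_def)
qed

lemma L2_measurable: "L2 u \<Longrightarrow> u \<in> borel_measurable borel"
  by (simp add: L2_def)

lemma integrable_inner_L2:
  assumes "L2 u" "L2 v"
  shows "integrable lborel (\<lambda>x. u x \<bullet> v x)"
proof (rule Bochner_Integration.integrable_bound[OF _ _ AE_I2])
  show "integrable lborel (\<lambda>x. (norm (u x))\<^sup>2 + (norm (v x))\<^sup>2)"
    using assms by (intro Bochner_Integration.integrable_add) (auto simp: L2_def)
  show "(\<lambda>x. u x \<bullet> v x) \<in> borel_measurable lborel"
    using assms[THEN L2_measurable] by measurable
  fix x
  have "\<bar>u x \<bullet> v x\<bar> \<le> norm (u x) * norm (v x)" by (rule Cauchy_Schwarz_ineq2)
  also have "\<dots> \<le> (norm (u x))\<^sup>2 + (norm (v x))\<^sup>2"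
    using sum_squares_bound[of "norm (u x)" "norm (v x)"] mult_nonneg_nonneg[of "norm (u x)" "norm (v x)"]
    by (simp del: mult_nonneg_nonneg)
  finally show "norm (u x \<bullet> v x) \<le> norm ((norm (u x))\<^sup>2 + (norm (v x))\<^sup>2)" by simp
qed

lemma L2_add:
  assumes "L2 u" "L2 v"
  shows "L2 (\<lambda>x. u x + v x)"
proof -
  have "integrable lborel (\<lambda>x. u x \<bullet> u x + 2 * (u x \<bullet> v x) + v x \<bullet> v x)"
    using assms by (intro Bochner_Integration.integrable_add integrable_mult_right integrable_inner_L2)
  moreover have "(\<lambda>x. u x \<bullet> u x + 2 * (u x \<bullet> v x) + v x \<bullet> v x) = (\<lambda>x. (norm (u x + v x))\<^sup>2)"
    by (rule ext) (simp add: power2_norm_eq_inner inner_add_left inner_add_right inner_commute)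
  moreover have "(\<lambda>x. u x + v x) \<in> borel_measurable lborel"
    using assms[THEN L2_measurable] by simp
  ultimately show ?thesis by (simp only: L2_def)
qed

lemma L2_scaleR: "L2 u \<Longrightarrow> L2 (\<lambda>x. c *\<^sub>R u x)"
  by (rule L2_dominated[where v = u and C = "\<bar>c\<bar>"])
    (auto intro: borel_measurable_scaleR L2_measurable)

lemma L2_bounded_mult:
  assumes "L2 u" "continuous_on UNIV A" "bounded (range A)"
  shows "L2 (\<lambda>x. A x * u x)"
proof -
  obtain C where "\<And>x. norm (A x) \<le> C" using assms(3) by (auto simp: bounded_iff)
  moreover have "A \<in> borel_measurable borel"
    using assms(2) by (rule borel_measurable_continuous_onI)
  ultimately show ?thesis
    using L2_measurable[OF assms(1)] assms(1)
    by (intro L2_dominated[where u = "\<lambda>x. A x * u x" and v = u and C = C])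
      (simp_all add: norm_mult mult_right_mono borel_measurable_times)
qed

lemma L2_cnj:
  assumes "L2 u"
  shows "L2 (\<lambda>x. cnj (u x))"
proof (rule L2_dominated[OF assms, where C = 1])
  have "cnj \<in> borel_measurable borel"
    by (intro borel_measurable_continuous_onI continuous_intros)
  from measurable_compose[OF L2_measurable[OF assms] this]
  show "(\<lambda>x. cnj (u x)) \<in> borel_measurable lborel" by simp
qed simp

text \<open>On a bounded interval the bound |u| \<le> 1 + |u|^2 is enough. It supplies the
  hypothesis on the weak second derivative in the integration by parts.\<close>

lemma L2_absolutely_integrable_interval:
  assumes "L2 u"
  shows "u absolutely_integrable_on {a..b}"
proof -
  have "integrable lborel (\<lambda>x. indicator {a..b} x *\<^sub>R u x)"
  proof (rule Bochner_Integration.integrable_bound[OF _ _ AE_I2])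
    show "integrable lborel (\<lambda>x. indicator {a..b} x + (norm (u x))\<^sup>2 :: real)"
      using assms by (intro Bochner_Integration.integrable_add integrable_real_indicator)
        (auto simp: L2_def emeasure_lborel_Icc_eq)
    show "(\<lambda>x. indicator {a..b} x *\<^sub>R u x) \<in> borel_measurable lborel"
      using L2_measurable[OF assms] by measurable
    fix x
    have "norm (u x) \<le> 1 + (norm (u x))\<^sup>2"
      using sum_squares_bound[of "norm (u x)" 1] norm_ge_zero[of "u x"]
      by (simp del: norm_ge_zero) 
    then show "norm (indicator {a..b} x *\<^sub>R u x) \<le> norm (indicator {a..b} x + (norm (u x))\<^sup>2 :: real)"
      by (auto split: split_indicator)
  qed
  then show ?thesis
    unfolding set_integrable_def by (rule integrable_completion[THEN iffD2, rotated]) 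
      (use L2_measurable[OF assms] in measurable)
qed

section \<open>The quadratic form of the linearized operator\<close>

text \<open>The two integrands differ by the derivative, in the integrated sense, of an integrable
  function, so their integrals agree. Boundedness of \<open>A\<close> and \<open>A'\<close> keeps
  every term in L^2.\<close>

lemma integral_linearized_operator:
  fixes A A' h h1 h2 :: "real \<Rightarrow> complex"
  assumes dA: "\<And>x. (A has_vector_derivative A' x) (at x)"
    and cA': "continuous_on UNIV A'"
    and bA: "bounded (range A)" and bA': "bounded (range A')"
    and H2: "H2_with h h1 h2"
  shows "integrable lborel (\<lambda>x. (norm (h1 x - cnj (A x * h x)))\<^sup>2)"
    and "(LINT x|lborel. (- h2 x + (cnj (A x) * A x * h x + cnj (A' x * h x))) \<bullet> h x)
          = (LINT x|lborel. (norm (h1 x - cnj (A x * h x)))\<^sup>2)"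
proof -
  have dh: "(h has_vector_derivative h1 x) (at x)" for x
    using H2 by (simp add: H2_with_def)
  have dh1: "(h2 has_integral (h1 b - h1 a)) {a..b}" if "a \<le> b" for a b
    using H2 that by (simp add: H2_with_def)
  have L2: "L2 h" "L2 h1" "L2 h2" using H2 by (auto simp: H2_with_def)
  have cA: "continuous_on UNIV A"
    using dA by (intro continuous_at_imp_continuous_on) (blast intro: has_vector_derivative_continuous)
  have ch: "continuous_on UNIV h"
    using dh by (intro continuous_at_imp_continuous_on) (blast intro: has_vector_derivative_continuous)
  have ch1: "continuous_on UNIV h1"
    using isCont_if_indefinite_integral[OF dh1] by (intro continuous_at_imp_continuous_on) blast
  have LA: "L2 (\<lambda>x. cnj (A x * h x))"
    by (intro L2_cnj L2_bounded_mult L2 cA bA)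
  have LA': "L2 (\<lambda>x. cnj (A' x * h x))"
    by (intro L2_cnj L2_bounded_mult L2 cA' bA')
  have LAA: "L2 (\<lambda>x. cnj (A x) * (A x * h x))"
  proof (intro L2_bounded_mult L2 cA bA)
    show "continuous_on UNIV (\<lambda>x. cnj (A x))" by (intro continuous_intros cA)
    show "bounded (range (\<lambda>x. cnj (A x)))" using bA by (simp add: bounded_iff)
  qed
  have LD: "L2 (\<lambda>x. h1 x + (-1) *\<^sub>R cnj (A x * h x))"
    by (intro L2_add L2_scaleR L2 LA)
  then show iD: "integrable lborel (\<lambda>x. (norm (h1 x - cnj (A x * h x)))\<^sup>2)"
    by (simp add: L2_def)
  have LL: "L2 (\<lambda>x. (-1) *\<^sub>R h2 x + (cnj (A x) * (A x * h x) + cnj (A' x * h x)))"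
    by (intro L2_add L2_scaleR L2 LAA LA')
  have iL: "integrable lborel (\<lambda>x. (- h2 x + (cnj (A x) * A x * h x + cnj (A' x * h x))) \<bullet> h x)"
    using integrable_inner_L2[OF LL L2(1)] by (simp add: mult.assoc)
  \<comment> \<open>\<open>B\<close> is minus the inner product of Dh with h, the boundary term
    produced by moving D to the other side; \<open>q\<close> is its formal derivative.\<close>
  define B where "B x = cnj (A x * h x) \<bullet> h x - h1 x \<bullet> h x" for x
  define q where "q x = cnj (A' x * h x + A x * h1 x) \<bullet> h x + cnj (A x * h x) \<bullet> h1 x
     - (h2 x \<bullet> h x + h1 x \<bullet> h1 x)" for x
  \<comment> \<open>The mixed terms match by symmetry: \<open>cnj (A x * h1 x) \<bullet> h x = cnj
    (A x * h x) \<bullet> h1 x\<close>. The term \<open>cnj (A x) * A x * h x\<close> paired with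
    \<open>h x\<close> cancels the square of |A h|.\<close>
  have q_eq: "q x = (- h2 x + (cnj (A x) * A x * h x + cnj (A' x * h x))) \<bullet> h x
     - (norm (h1 x - cnj (A x * h x)))\<^sup>2" for x
    unfolding q_def power2_norm_eq_inner by (simp add: inner_complex_def algebra_simps)
  have "(LINT x|lborel. q x) = 0"
  proof (rule integral_derivative_of_integrable[where B = B])
    show "integrable lborel B"
      unfolding B_def by (intro Bochner_Integration.integrable_diff integrable_inner_L2 L2 LA)
    show "integrable lborel q"
      unfolding q_eq by (intro Bochner_Integration.integrable_diff iL iD)
    fix a b :: real assume ab: "a \<le> b"
    have "((\<lambda>x. cnj (A x * h x) \<bullet> h x) has_vector_derivative
       (cnj (A' x * h x + A x * h1 x) \<bullet> h x + cnj (A x * h x) \<bullet> h1 x)) (at x within {a..b})" for x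
      unfolding has_vector_derivative_def
      by (rule derivative_eq_intros has_derivative_at_withinI[OF dA[unfolded has_vector_derivative_def]]
         has_derivative_at_withinI[OF dh[unfolded has_vector_derivative_def]] refl)+
        (auto simp: fun_eq_iff algebra_simps)
    then have "((\<lambda>x. cnj (A' x * h x + A x * h1 x) \<bullet> h x + cnj (A x * h x) \<bullet> h1 x) has_integral
        (cnj (A b * h b) \<bullet> h b - cnj (A a * h a) \<bullet> h a)) {a..b}"
      by (intro fundamental_theorem_of_calculus ab) auto
    moreover have "((\<lambda>x. h2 x \<bullet> h x + h1 x \<bullet> h1 x) has_integral (h1 b \<bullet> h b - h1 a \<bullet> h a)) {a..b}"
      by (intro integration_by_parts_indefinite ab dh1 L2_absolutely_integrable_interval L2 dh ch1)
    ultimately have "(q has_integral (cnj (A b * h b) \<bullet> h b - cnj (A a * h a) \<bullet> h a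
        - (h1 b \<bullet> h b - h1 a \<bullet> h a))) {a..b}"
      unfolding q_def by (rule has_integral_diff)
    then show "(q has_integral (B b - B a)) {a..b}" by (simp add: B_def algebra_simps)
  qed
  then show "(LINT x|lborel. (- h2 x + (cnj (A x) * A x * h x + cnj (A' x * h x))) \<bullet> h x)
          = (LINT x|lborel. (norm (h1 x - cnj (A x * h x)))\<^sup>2)"
    unfolding q_eq using Bochner_Integration.integral_diff[OF iL iD] by simp
qed

section \<open>Gradient and Hessian of the squared modulus of an entire function\<close>

text \<open>By the Cauchy-Riemann equations the real derivative of \<open>f\<close> is
  multiplication by \<open>deriv f z\<close>, whose adjoint is multiplication by the
  conjugate.\<close>

lemma has_derivative_norm_sq_holomorphic:
  assumes "f holomorphic_on UNIV"
  shows "((\<lambda>z. (cmod (f z))\<^sup>2) has_derivative (\<lambda>h. (2 * f z * cnj (deriv f z)) \<bullet> h)) (at z)"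
proof -
  have "(f has_field_derivative deriv f z) (at z)"
    using assms by (rule holomorphic_derivI) auto
  then have d: "(f has_derivative (\<lambda>h. deriv f z * h)) (at z)" by (simp add: has_field_derivative_def)
  show ?thesis
    unfolding power2_norm_eq_inner
    by (rule derivative_eq_intros d refl)+ (simp add: fun_eq_iff inner_complex_def algebra_simps)
qed

lemma grad_norm_sq_holomorphic:
  assumes "f holomorphic_on UNIV"
  shows "grad (\<lambda>z. (cmod (f z))\<^sup>2) = (\<lambda>z. 2 * f z * cnj (deriv f z))"
proof
  fix z
  let ?g = "2 * f z * cnj (deriv f z)"
  show "grad (\<lambda>z. (cmod (f z))\<^sup>2) z = ?g"
    unfolding grad_def
  proof (rule the_equality)
    show "((\<lambda>z. (cmod (f z))\<^sup>2) has_derivative (\<lambda>h. ?g \<bullet> h)) (at z)"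
      by (rule has_derivative_norm_sq_holomorphic[OF assms])
    fix g assume "((\<lambda>z. (cmod (f z))\<^sup>2) has_derivative (\<lambda>h. g \<bullet> h)) (at z)"
    then have "(\<lambda>h. g \<bullet> h) = (\<lambda>h. ?g \<bullet> h)"
      by (rule has_derivative_unique[OF _ has_derivative_norm_sq_holomorphic[OF assms]])
    then show "g = ?g" by (metis vector_eq_rdot)
  qed
qed

text \<open>The derivative has a complex-linear part and a conjugate-linear part. Along the orbit
  they become \<open>cnj A * A * h\<close> and \<open>cnj (A' * h)\<close>.\<close>

lemma has_derivative_grad_norm_sq_holomorphic:
  assumes "f holomorphic_on UNIV"
  shows "((\<lambda>z. 2 * f z * cnj (deriv f z)) has_derivative
     (\<lambda>h. 2 * (cnj (deriv f z) * deriv f z * h + f z * cnj (deriv (deriv f) z * h)))) (at z)"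
proof -
  have "(f has_field_derivative deriv f z) (at z)"
    using assms by (rule holomorphic_derivI) auto
  then have d: "(f has_derivative (\<lambda>h. deriv f z * h)) (at z)" by (simp add: has_field_derivative_def)
  have "deriv f holomorphic_on UNIV" using assms by (rule holomorphic_deriv) simp
  then have "(deriv f has_field_derivative deriv (deriv f) z) (at z)"
    by (rule holomorphic_derivI) auto
  then have d': "(deriv f has_derivative (\<lambda>h. deriv (deriv f) z * h)) (at z)"
    by (simp add: has_field_derivative_def)
  show ?thesis
    by (rule derivative_eq_intros d d' refl)+ (simp add: fun_eq_iff algebra_simps)
qed

lemma hess_norm_sq_holomorphic:
  assumes "f holomorphic_on UNIV"
  shows "hess (\<lambda>z. (cmod (f z))\<^sup>2) z =
    (\<lambda>h. 2 * (cnj (deriv f z) * deriv f z * h + f z * cnj (deriv (deriv f) z * h)))"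
  unfolding hess_def grad_norm_sq_holomorphic[OF assms]
  using has_derivative_grad_norm_sq_holomorphic[OF assms]
  by (intro the_equality) (auto intro: has_derivative_unique)

section \<open>Heteroclinic orbits and their first-order equation\<close>

lemma bounded_range_if_tendsto:
  fixes e :: "real \<Rightarrow> 'a::real_normed_vector"
  assumes c: "continuous_on UNIV e" and m: "(e \<longlongrightarrow> l) at_bot" and p: "(e \<longlongrightarrow> r) at_top"
  shows "bounded (range e)"
proof -
  have "eventually (\<lambda>x. dist (e x) l < 1) at_bot" using m by (rule tendstoD) simp
  then obtain a where a: "\<And>x. x \<le> a \<Longrightarrow> dist (e x) l < 1" by (auto simp: eventually_at_bot_linorder)
  have "eventually (\<lambda>x. dist (e x) r < 1) at_top" using p by (rule tendstoD) simp
  then obtain b where b: "\<And>x. x \<ge> b \<Longrightarrow> dist (e x) r < 1" by (auto simp: eventually_at_top_linorder)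
  have "range e \<subseteq> cball l 1 \<union> cball r 1 \<union> e ` {a..b}"
  proof safe
    fix x assume "e x \<notin> e ` {a..b}" "e x \<notin> cball r 1"
    then have "x \<le> a" using b[of x] by (force simp: dist_commute not_le)
    then show "e x \<in> cball l 1" using a[of x] by (simp add: dist_commute)
  qed
  moreover have "bounded (e ` {a..b})"
    by (intro compact_imp_bounded compact_continuous_image continuous_on_subset[OF c]) auto
  ultimately show ?thesis by (meson bounded_Un bounded_cball bounded_subset)
qed

lemma bounded_range_compose:
  fixes e :: "real \<Rightarrow> 'a::heine_borel" and \<phi> :: "'a \<Rightarrow> 'b::real_normed_vector"
  assumes "bounded (range e)" "continuous_on UNIV \<phi>"
  shows "bounded (range (\<lambda>x. \<phi> (e x)))"
proof -
  have "compact (closure (range e))" using assms(1) by (simp add: compact_closure)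
  then have "bounded (\<phi> ` closure (range e))"
    by (intro compact_imp_bounded compact_continuous_image continuous_on_subset[OF assms(2)]) auto
  then show ?thesis by (rule bounded_subset) (use closure_subset[of "range e"] in auto)
qed

text \<open>Far out, \<open>e'\<close> is nearly constant on a unit interval because
  \<open>e''\<close> is small, so \<open>e' x\<close> is close to \<open>e (x+1) - e x\<close>,
  which tends to 0. The errors are \<open>\<epsilon> / 3\<close> and
  \<open>2 * \<epsilon> / 3\<close>.\<close>

lemma derivative_tendsto_0:
  fixes e e' e'' :: "real \<Rightarrow> 'a::real_normed_vector"
  assumes d1: "\<And>x. (e has_vector_derivative e' x) (at x)"
    and d2: "\<And>x. (e' has_vector_derivative e'' x) (at x)"
    and lim: "(e \<longlongrightarrow> l) at_top" and lim2: "(e'' \<longlongrightarrow> 0) at_top"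
  shows "(e' \<longlongrightarrow> 0) at_top"
proof (rule tendstoI)
  fix \<epsilon> :: real assume \<epsilon>: "\<epsilon> > 0"
  have "\<forall>\<^sub>F x in at_top. dist (e x) l < \<epsilon> / 3" using lim \<epsilon> by (intro tendstoD) auto
  then obtain a where a: "\<And>x. x \<ge> a \<Longrightarrow> dist (e x) l < \<epsilon> / 3" by (auto simp: eventually_at_top_linorder)
  have "\<forall>\<^sub>F x in at_top. dist (e'' x) 0 < \<epsilon> / 3" using lim2 \<epsilon> by (intro tendstoD) auto
  then obtain b where b: "\<And>x. x \<ge> b \<Longrightarrow> norm (e'' x) < \<epsilon> / 3" by (auto simp: eventually_at_top_linorder)
  have "norm (e' x) < \<epsilon>" if x: "x \<ge> max a b" for x
  proof -
    have e'_near: "norm (e' y - e' x) \<le> \<epsilon> / 3" if y: "y \<in> {x..x+1}" for y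
    proof -
      have "norm (e' y - e' x) \<le> \<epsilon> / 3 * norm (y - x)"
      proof (rule differentiable_bound[where S = "{x..x+1}" and f' = "\<lambda>t h. h *\<^sub>R e'' t"])
        show "(e' has_derivative (\<lambda>h. h *\<^sub>R e'' t)) (at t within {x..x+1})" for t
          using d2[of t] by (auto simp: has_vector_derivative_def intro: has_derivative_at_withinI)
        show "onorm (\<lambda>h. h *\<^sub>R e'' t) \<le> \<epsilon> / 3" if "t \<in> {x..x+1}" for t
        proof (rule onorm_bound)
          fix h :: real
          have "norm (e'' t) \<le> \<epsilon> / 3" using b[of t] that x by simp
          then show "norm (h *\<^sub>R e'' t) \<le> \<epsilon> / 3 * norm h"
            using mult_left_mono[of "norm (e'' t)" "\<epsilon> / 3" "\<bar>h\<bar>"] by (simp add: mult.commute)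
        qed (use \<epsilon> in simp)
      qed (use y in auto)
      also have "\<dots> \<le> \<epsilon> / 3 * 1" using y \<epsilon> by (intro mult_left_mono) auto
      finally show ?thesis by simp
    qed
    have "norm (e (x+1) - e x - (x + 1 - x) *\<^sub>R e' x) \<le> norm (x + 1 - x) * (\<epsilon> / 3)"
      by (rule vector_differentiable_bound_linearization[where S = "{x..x+1}"])
        (use e'_near in \<open>auto intro: has_vector_derivative_at_within d1 simp: closed_segment_eq_real_ivl\<close>)
    then have "norm (e (x+1) - e x - e' x) \<le> \<epsilon> / 3" by simp
    moreover have "norm (e (x+1) - e x) < 2 * \<epsilon> / 3"
      using a[of x] a[of "x+1"] x dist_triangle2[of "e (x+1)" "e x" l] by (simp add: dist_norm)
    ultimately show ?thesis
      using norm_triangle_ineq4[of "e (x+1) - e x" "e (x+1) - e x - e' x"] by simp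
  qed
  then show "\<forall>\<^sub>F x in at_top. dist (e' x) 0 < \<epsilon>"
    by (intro eventually_at_top_linorderI[of "max a b"]) simp
qed

lemma heteroclinic_first_order:
  fixes f :: "complex \<Rightarrow> complex" and e e' :: "real \<Rightarrow> complex"
  assumes hol: "f holomorphic_on UNIV"
    and neq: "am \<noteq> ap" and fp: "f ap = 0"
    and d1: "\<And>x. (e has_vector_derivative e' x) (at x)"
    and d2: "\<And>x. (e' has_vector_derivative 2 * f (e x) * cnj (deriv f (e x))) (at x)"
    and lim_m: "(e \<longlongrightarrow> am) at_bot" and lim_p: "(e \<longlongrightarrow> ap) at_top"
  obtains c where "(cmod c)\<^sup>2 = 2" "\<And>x. e' x = cnj (c * f (e x))" "\<And>x. e' x \<noteq> 0"
proof -
  have ce: "continuous_on UNIV e"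
    using d1 by (intro continuous_at_imp_continuous_on) (blast intro: has_vector_derivative_continuous)
  have cf: "continuous_on UNIV f" and cf': "continuous_on UNIV (deriv f)"
    using hol by (auto intro!: holomorphic_on_imp_continuous_on holomorphic_deriv)
  have df: "((\<lambda>x. f (e x)) has_vector_derivative e' x * deriv f (e x)) (at x)" for x
    using field_vector_diff_chain_at[OF d1 holomorphic_derivI[OF hol]] by (simp add: o_def)
  have fl: "((\<lambda>x. f (e x)) \<longlongrightarrow> 0) at_top"
    using isCont_tendsto_compose[OF _ lim_p, of f] cf fp by (simp add: continuous_on_eq_continuous_at)
  have f'l: "((\<lambda>x. deriv f (e x)) \<longlongrightarrow> deriv f ap) at_top"
    using isCont_tendsto_compose[OF _ lim_p, of "deriv f"] cf' by (simp add: continuous_on_eq_continuous_at)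
  have "((\<lambda>x. 2 * f (e x) * cnj (deriv f (e x))) \<longlongrightarrow> 2 * 0 * cnj (deriv f ap)) at_top"
    by (intro tendsto_intros fl f'l)
  then have e'l: "(e' \<longlongrightarrow> 0) at_top"
    using derivative_tendsto_0[OF d1 d2 lim_p] by simp
  txt \<open>The conserved energy vanishes because both $f(e)$ and $e'$ tend to $0$ at $+\<infinity>$.\<close>
  define E where "E x = (cmod (e' x))\<^sup>2 - 2 * (cmod (f (e x)))\<^sup>2" for x
  have "(E has_vector_derivative 0) (at x)" for x
    unfolding E_def power2_norm_eq_inner has_vector_derivative_def
    by (rule derivative_eq_intros d2[unfolded has_vector_derivative_def]
      df[unfolded has_vector_derivative_def] refl)+
      (simp add: fun_eq_iff inner_complex_def algebra_simps)
  then obtain C where C: "E x = C" for x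
    using has_vector_derivative_zero_constant[of UNIV E] by auto
  have "(E \<longlongrightarrow> (cmod 0)\<^sup>2 - 2 * (cmod 0)\<^sup>2) at_top"
    unfolding E_def by (intro tendsto_intros e'l fl)
  then have "((\<lambda>x::real. C) \<longlongrightarrow> 0) at_top" by (simp add: C[abs_def])
  then have "C = 0" by (rule tendsto_unique[OF trivial_limit_at_top_linorder tendsto_const])
  then have energy: "(cmod (e' x))\<^sup>2 = 2 * (cmod (f (e x)))\<^sup>2" for x
    using C[of x] by (simp add: E_def)
  have energy': "cmod (e' x) = sqrt 2 * cmod (f (e x))" for x
    using energy[of x] by (metis norm_ge_zero real_sqrt_mult real_sqrt_unique)
  obtain K where K: "\<And>x. cmod (deriv f (e x)) \<le> K"
    using bounded_range_compose[OF bounded_range_if_tendsto[OF ce lim_m lim_p] cf']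
    by (auto simp: bounded_iff)
  have e'_nz: "e' x \<noteq> 0" for x
  proof
    assume z: "e' x = 0"
    \<comment> \<open>Equipartition bounds \<open>f (e t)\<close> by a multiple of
      \<open>e' t\<close>, so the second-order equation becomes a linear differential inequality for
      \<open>e'\<close> alone. A single zero of \<open>e'\<close> would then make \<open>e\<close>
      constant, against the two distinct limits.\<close>
    have "e' y = 0" for y
    proof (rule gronwall_vanish[OF d2 _ z, of "sqrt 2 * K"])
      fix t
      have "cmod (2 * f (e t) * cnj (deriv f (e t))) = sqrt 2 * cmod (deriv f (e t)) * cmod (e' t)"
        by (simp add: norm_mult energy')
      also have "\<dots> \<le> sqrt 2 * K * cmod (e' t)"
        by (intro mult_right_mono mult_left_mono K) auto
      finally show "cmod (2 * f (e t) * cnj (deriv f (e t))) \<le> sqrt 2 * K * cmod (e' t)" .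
    qed
    then obtain d where "\<And>y. e y = d"
      using has_vector_derivative_zero_constant[of UNIV e] d1 by auto
    then have "e = (\<lambda>y. d)" by auto
    then have "((\<lambda>y::real. d) \<longlongrightarrow> am) at_bot" "((\<lambda>y::real. d) \<longlongrightarrow> ap) at_top"
      using lim_m lim_p by auto
    then have "am = d" "ap = d"
      using tendsto_unique[OF trivial_limit_at_bot_linorder _ tendsto_const]
        tendsto_unique[OF trivial_limit_at_top_linorder _ tendsto_const] by blast+
    then show False using neq by simp
  qed
  then have f_nz: "f (e x) \<noteq> 0" for x using energy'[of x] by auto
  txt \<open>By equipartition of energy, $\overline{e'}/f(e)$ is constant.\<close>
  define r where "r x = cnj (e' x) / f (e x)" for x
  have "(r has_vector_derivative 0) (at x)" for x
  proof -
    \<comment> \<open>This is equipartition in product form; it makes the two terms in the numerator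
      of the quotient rule for \<open>r\<close> equal.\<close>
    have "cnj (e' x) * e' x = 2 * (f (e x) * cnj (f (e x)))"
      using energy[of x] by (metis complex_norm_square mult.commute of_real_mult of_real_numeral)
    then have "cnj (e' x) * (e' x * deriv f (e x)) = 2 * cnj (f (e x)) * deriv f (e x) * f (e x)"
      by (simp add: algebra_simps)
    moreover have "(r has_vector_derivative
      ((2 * cnj (f (e x)) * deriv f (e x)) * f (e x) - cnj (e' x) * (e' x * deriv f (e x))) / (f (e x) * f (e x))) (at x)"
      unfolding r_def has_vector_derivative_def
      by (rule derivative_eq_intros d2[unfolded has_vector_derivative_def]
        df[unfolded has_vector_derivative_def] refl f_nz)+
        (use f_nz[of x] in \<open>simp add: fun_eq_iff field_simps scaleR_conv_of_real\<close>)
    ultimately show ?thesis by (simp only: diff_self div_0)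
  qed
  then obtain c where c: "r x = c" for x
    using has_vector_derivative_zero_constant[of UNIV r] by auto
  have e'c: "cnj (e' x) = c * f (e x)" for x
    using c[of x] f_nz[of x] by (simp add: r_def field_simps)
  show thesis
  proof (rule that)
    have "cmod (cnj (e' 0)) = cmod c * cmod (f (e 0))" by (simp only: e'c norm_mult)
    then have "cmod c = sqrt 2" using energy'[of 0] f_nz[of 0] by simp
    then show "(cmod c)\<^sup>2 = 2" by simp
    show "e' x = cnj (c * f (e x))" for x using e'c[of x] by (metis complex_cnj_cnj)
  qed (rule e'_nz)
qed

text \<open>The equation says that \<open>e\<close> is a gradient-flow line of Re G, where G is a
  primitive of \<open>g\<close>; the total increase of Re G along \<open>e\<close> is the integral
  of |g(e)|^2. With g = c f this puts \<open>e'\<close> in L^2.\<close>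

lemma L2_gradient_orbit:
  assumes hol: "g holomorphic_on UNIV"
    and d: "\<And>x. (e has_vector_derivative cnj (g (e x))) (at x)"
    and lim_m: "(e \<longlongrightarrow> am) at_bot" and lim_p: "(e \<longlongrightarrow> ap) at_top"
  shows "L2 (\<lambda>x. g (e x))"
proof -
  have ce: "continuous_on UNIV e"
    using d by (intro continuous_at_imp_continuous_on) (blast intro: has_vector_derivative_continuous)
  have cg: "continuous_on UNIV (\<lambda>x. g (e x))"
    using holomorphic_on_imp_continuous_on[OF hol] ce by (rule continuous_on_compose2) auto
  obtain G where G: "\<And>z. (G has_field_derivative g z) (at z)"
    using holomorphic_convex_primitive'[OF convex_UNIV open_UNIV hol] by auto
  txt \<open>With $G' = g$, the square $|g(e)|^2$ is the derivative of the bounded function $\mathrm{Re}\, G(e)$.\<close>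
  define F where "F x = Re (G (e x))" for x
  have dF: "(F has_real_derivative (cmod (g (e x)))\<^sup>2) (at x)" for x
  proof -
    have "((\<lambda>x. G (e x)) has_vector_derivative cnj (g (e x)) * g (e x)) (at x)"
      using field_vector_diff_chain_at[OF d G] by (simp add: o_def)
    then have "(F has_vector_derivative Re (cnj (g (e x)) * g (e x))) (at x)"
      unfolding F_def by (rule bounded_linear.has_vector_derivative[OF bounded_linear_Re])
    moreover have "Re (cnj (g (e x)) * g (e x)) = (cmod (g (e x)))\<^sup>2"
      by (simp only: cmod_power2) (simp add: power2_eq_square)
    ultimately show ?thesis by (simp add: has_real_derivative_iff_has_vector_derivative)
  qed
  have Fl: "(F \<longlongrightarrow> Re (G a)) L" if "(e \<longlongrightarrow> a) L" for a L
    unfolding F_def using isCont_tendsto_compose[OF DERIV_isCont[OF G] that] by (rule tendsto_Re)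
  \<comment> \<open>For a nonnegative integrand, finite limits of the antiderivative at both ends
    already give integrability.\<close>
  have "set_integrable lborel (einterval (-\<infinity>) \<infinity>) (\<lambda>x. (cmod (g (e x)))\<^sup>2)"
  proof (rule interval_integral_FTC_nonneg(1))
    show "((F \<circ> real_of_ereal) \<longlongrightarrow> Re (G am)) (at_right (-\<infinity>))"
      using Fl[OF lim_m] by (simp add: ereal_tendsto_simps)
    show "((F \<circ> real_of_ereal) \<longlongrightarrow> Re (G ap)) (at_left \<infinity>)"
      using Fl[OF lim_p] by (simp add: ereal_tendsto_simps)
    show "isCont (\<lambda>x. (cmod (g (e x)))\<^sup>2) x" for x
      using cg by (intro continuous_intros) (simp add: continuous_on_eq_continuous_at)
  qed (simp_all add: dF)
  then have "integrable lborel (\<lambda>x. (cmod (g (e x)))\<^sup>2)"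
    by (simp add: set_integrable_def einterval_eq_UNIV)
  then show ?thesis using cg by (simp add: L2_def borel_measurable_continuous_onI)
qed

section \<open>Nonnegativity and the kernel\<close>

theorem theorem1:
  fixes f :: "complex \<Rightarrow> complex" and W :: "complex \<Rightarrow> real"
    and am ap :: complex and e e' :: "real \<Rightarrow> complex"
  assumes hol: "f holomorphic_on UNIV"
    and W_def: "\<And>z. W z = (cmod (f z))\<^sup>2"
    and neq: "am \<noteq> ap"
    and zm: "nondeg_zero W am" and zp: "nondeg_zero W ap"
    and d1: "\<And>x. (e has_vector_derivative e' x) (at x)"
    and d2: "\<And>x. (e' has_vector_derivative grad W (e x)) (at x)"
    and C2: "continuous_on UNIV (\<lambda>x. grad W (e x))"
    and lim_m: "(e \<longlongrightarrow> am) at_bot"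
    and lim_p: "(e \<longlongrightarrow> ap) at_top"
  shows "(\<forall>h h1 h2. H2_with h h1 h2 \<longrightarrow>
            (LINT x|lborel. (- h2 x + hess W (e x) (h x)) \<bullet> h x) \<ge> 0)
       \<and> (\<exists>v \<in> kerL W e. v \<noteq> (\<lambda>x. 0) \<and> kerL W e \<subseteq> {(\<lambda>x. c *\<^sub>R v x) | c. True})
       \<and> kerL W e = {(\<lambda>x. c *\<^sub>R e' x) | c. True}"
proof -
  have W: "W = (\<lambda>z. (cmod (f z))\<^sup>2)" using W_def by auto
  have fp: "f ap = 0" using zp by (simp add: nondeg_zero_def W_def)
  have gradW: "grad W z = 2 * f z * cnj (deriv f z)" for z
    by (simp add: W grad_norm_sq_holomorphic[OF hol])
  have hol': "deriv f holomorphic_on UNIV" and hol'': "deriv (deriv f) holomorphic_on UNIV"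
    using hol by (auto intro!: holomorphic_deriv)
  obtain c where c: "(cmod c)\<^sup>2 = 2" and e'c: "\<And>x. e' x = cnj (c * f (e x))"
    and e'_nz: "\<And>x. e' x \<noteq> 0"
    using heteroclinic_first_order[OF hol neq fp d1 d2[unfolded gradW] lim_m lim_p] by blast
  have cc: "cnj c * c = 2" using c by (metis complex_norm_square mult.commute of_real_numeral)
  have ce: "continuous_on UNIV e"
    using d1 by (intro continuous_at_imp_continuous_on) (blast intro: has_vector_derivative_continuous)
  have be: "bounded (range e)" by (rule bounded_range_if_tendsto[OF ce lim_m lim_p])
  have comp: "continuous_on UNIV (\<lambda>x. \<phi> (e x))" "bounded (range (\<lambda>x. \<phi> (e x)))"
    if "continuous_on UNIV \<phi>" for \<phi> :: "complex \<Rightarrow> complex"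
    using continuous_on_compose2[OF that ce] bounded_range_compose[OF be that] by auto
  have cf: "continuous_on UNIV f" "continuous_on UNIV (deriv f)" "continuous_on UNIV (deriv (deriv f))"
    using hol hol' hol'' by (auto intro: holomorphic_on_imp_continuous_on)
  \<comment> \<open>With g = c f these are g'(e) and its derivative g''(e) e'. Writing
    \<open>e'\<close> as \<open>cnj (c * f (e x))\<close> makes both continuous functions of
    \<open>e x\<close>, hence bounded because \<open>e\<close> has bounded range.\<close>
  define A where "A x = c * deriv f (e x)" for x
  define A' where "A' x = c * deriv (deriv f) (e x) * cnj (c * f (e x))" for x
  have cA: "continuous_on UNIV A" and bA: "bounded (range A)"
    unfolding A_def by (intro comp[where \<phi> = "\<lambda>z. c * deriv f z"] continuous_intros cf)+
  have cA': "continuous_on UNIV A'" and bA': "bounded (range A')"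
    unfolding A'_def
    by (intro comp[where \<phi> = "\<lambda>z. c * deriv (deriv f) z * cnj (c * f z)"] continuous_intros cf)+
  have dA: "(A has_vector_derivative A' x) (at x)" for x
    using has_vector_derivative_mult_right[OF
        field_vector_diff_chain_at[OF d1 holomorphic_derivI[OF hol' open_UNIV UNIV_I]], of c x]
    by (simp add: A_def[abs_def] A'_def o_def e'c ac_simps)
  have hessW: "hess W (e x) k = cnj (A x) * A x * k + cnj (A' x * k)" for x k
  proof -
    have "cnj (A x) * A x * k + cnj (A' x * k) =
      (cnj c * c) * (cnj (deriv f (e x)) * deriv f (e x) * k + f (e x) * cnj (deriv (deriv f) (e x) * k))"
      by (simp add: A_def A'_def algebra_simps)
    then show ?thesis by (simp only: cc W hess_norm_sq_holomorphic[OF hol])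
  qed
  \<comment> \<open>Read as D e' = 0: translation invariance puts \<open>e'\<close> in the kernel of
    the first-order factor.\<close>
  have e'': "grad W (e x) = cnj (A x * e' x)" for x
  proof -
    have "cnj (A x * e' x) = (cnj c * c) * f (e x) * cnj (deriv f (e x))"
      by (simp add: A_def e'c)
    then show ?thesis by (simp only: cc gradW)
  qed
  have de': "(e' has_vector_derivative cnj (A x * e' x)) (at x)" for x
    using d2[of x] by (simp add: e'')

  have "L2 (\<lambda>x. c * f (e x))"
  proof (rule L2_gradient_orbit[OF _ _ lim_m lim_p])
    show "(\<lambda>z. c * f z) holomorphic_on UNIV" by (intro holomorphic_intros hol)
    show "(e has_vector_derivative cnj (c * f (e x))) (at x)" for x using d1[of x] by (simp only: e'c)
  qed
  from L2_cnj[OF this] have L2e': "L2 e'" by (simp only: e'c[symmetric])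
  have L2mult: "L2 (\<lambda>x. cnj (B x * u x))" if "L2 u" "continuous_on UNIV B" "bounded (range B)" for B u
    using that by (intro L2_cnj L2_bounded_mult)
  \<comment> \<open>The third derivative of \<open>e\<close>, serving as the weak second derivative
    of \<open>e'\<close> in \<open>H2_with\<close>.\<close>
  define e3 where "e3 x = cnj (A' x * e' x + A x * cnj (A x * e' x))" for x
  have de'': "((\<lambda>x. cnj (A x * e' x)) has_vector_derivative e3 x) (at x)" for x
    unfolding e3_def has_vector_derivative_def
    by (rule derivative_eq_intros dA[unfolded has_vector_derivative_def]
       de'[unfolded has_vector_derivative_def] refl)+ (simp add: fun_eq_iff algebra_simps)
  have L2e'': "L2 (\<lambda>x. cnj (A x * e' x))" by (intro L2mult L2e' cA bA)
  have "L2 (\<lambda>x. cnj (A' x * e' x) + cnj (A x * cnj (A x * e' x)))"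
    by (intro L2_add L2mult L2e' L2e'' cA bA cA' bA')
  then have L2e3: "L2 e3" by (simp add: e3_def[abs_def])
  have H2e': "H2_with (\<lambda>x. t *\<^sub>R e' x) (\<lambda>x. t *\<^sub>R cnj (A x * e' x)) (\<lambda>x. t *\<^sub>R e3 x)" for t
    unfolding H2_with_def
  proof (intro conjI allI impI L2_scaleR L2e' L2e'' L2e3)
    show "((\<lambda>x. t *\<^sub>R e' x) has_vector_derivative t *\<^sub>R cnj (A x * e' x)) (at x)" for x
      by (rule bounded_linear.has_vector_derivative[OF bounded_linear_scaleR_right de'])
    fix a b :: real assume "a \<le> b"
    then show "((\<lambda>x. t *\<^sub>R e3 x) has_integral t *\<^sub>R cnj (A b * e' b) - t *\<^sub>R cnj (A a * e' a)) {a..b}"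
      by (rule fundamental_theorem_of_calculus)
        (rule has_vector_derivative_at_within,
          rule bounded_linear.has_vector_derivative[OF bounded_linear_scaleR_right de''])
  qed
  have e'_ker: "(\<lambda>x. t *\<^sub>R e' x) \<in> kerL W e" for t
    unfolding kerL_def using H2e'[of t]
    by (intro CollectI exI conjI) (auto simp: hessW e3_def scaleR_conv_of_real algebra_simps)

  have ker_sub: "\<exists>t. h = (\<lambda>x. t *\<^sub>R e' x)" if h_ker: "h \<in> kerL W e" for h
  proof -
    obtain h1 h2 where H2: "H2_with h h1 h2" and AE: "AE x in lborel. - h2 x + hess W (e x) (h x) = 0"
      using h_ker unfolding kerL_def by blast
    have dh: "(h has_vector_derivative h1 x) (at x)" for x
      using H2 by (simp add: H2_with_def)
    have L2h: "L2 h" using H2 by (simp add: H2_with_def)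
    have ch: "continuous_on UNIV h"
      using dh by (intro continuous_at_imp_continuous_on) (blast intro: has_vector_derivative_continuous)
    have ch1: "continuous_on UNIV h1"
      by (intro continuous_at_imp_continuous_on ballI, rule isCont_if_indefinite_integral[where u' = h2])
        (use H2 in \<open>simp add: H2_with_def\<close>)
    note op = integral_linearized_operator[OF dA cA' bA bA' H2]
    have "(LINT x|lborel. (- h2 x + (cnj (A x) * A x * h x + cnj (A' x * h x))) \<bullet> h x) = 0"
      using AE by (intro integral_eq_zero_AE) (auto simp: hessW)
    then have "AE x in lborel. (norm (h1 x - cnj (A x * h x)))\<^sup>2 = 0"
      using op by (subst integral_nonneg_eq_0_iff_AE[symmetric]) auto
    then have "AE x in lborel. h1 x - cnj (A x * h x) = 0" by simp
    \<comment> \<open>The integral of |Dh|^2 gives Dh = 0 only almost everywhere; continuity of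
      \<open>h1\<close>, \<open>A\<close> and \<open>h\<close> extends this to every point.\<close>
    then have "h1 x - cnj (A x * h x) = 0" for x
      by (rule AE_lborel_continuous_eq_0) (intro continuous_intros ch1 cA ch)
    then have dh: "(h has_vector_derivative cnj (A x * h x)) (at x)" for x using dh[of x] by simp
    txt \<open>$w = \mathrm{Im}(\overline{e'} h)$ is the Wronskian of two solutions of the trace-free first-order
      system, hence constant; being integrable, it vanishes.\<close>
    define w where "w x = (\<i> * e' x) \<bullet> h x" for x
    \<comment> \<open>The two terms of the product rule are the imaginary parts of
      \<open>A x * e' x * h x\<close> and of its conjugate.\<close>
    have "(w has_vector_derivative 0) (at x)" for x
      unfolding w_def has_vector_derivative_def
      by (rule derivative_eq_intros dh[unfolded has_vector_derivative_def]
         de'[unfolded has_vector_derivative_def] refl)+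
         (simp add: fun_eq_iff inner_complex_def algebra_simps)
    then obtain C where C: "w x = C" for x
      using has_vector_derivative_zero_constant[of UNIV w] by auto
    have "L2 (\<lambda>x. \<i> * e' x)" by (intro L2_bounded_mult L2e') auto
    then have "integrable lborel w"
      unfolding w_def by (intro integrable_inner_L2 L2h)
    \<comment> \<open>If \<open>C\<close> were nonzero, the choice
      \<open>\<delta> = \<bar>C\<bar>\<close> on the whole line would give a point with
      \<open>\<bar>C\<bar> < \<bar>C\<bar>\<close>.\<close>
    then have "C = 0"
      using integrable_lborel_small_value[of w UNIV "\<bar>C\<bar>"] by (force simp: C)
    \<comment> \<open>The coefficient of the projection of \<open>h 0\<close> onto
      \<open>e' 0\<close>. Since \<open>w 0 = 0\<close>, the product \<open>cnj (e' 0) * h 0\<close>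
      is real, so \<open>h 0\<close> equals its projection.\<close>
    define t where "t = (e' 0 \<bullet> h 0) / (norm (e' 0))\<^sup>2"
    have h0: "h 0 = t *\<^sub>R e' 0"
    proof -
      have "cnj (e' 0) * h 0 = of_real (e' 0 \<bullet> h 0)"
        using C[of 0] \<open>C = 0\<close> by (simp add: w_def complex_eq_iff inner_complex_def)
      then have "(cnj (e' 0) * e' 0) * h 0 = of_real (e' 0 \<bullet> h 0) * e' 0" by (simp add: ac_simps)
      moreover have "cnj (e' 0) * e' 0 = of_real ((norm (e' 0))\<^sup>2)"
        by (metis complex_norm_square mult.commute)
      ultimately have "of_real ((norm (e' 0))\<^sup>2) * h 0 = of_real (e' 0 \<bullet> h 0) * e' 0" by simp
      then show ?thesis
        using e'_nz[of 0] by (simp add: t_def scaleR_conv_of_real field_simps)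
    qed
    obtain K where K: "\<And>x. cmod (A x) \<le> K" using bA by (auto simp: bounded_iff)
    \<comment> \<open>Both \<open>h\<close> and \<open>t *\<^sub>R e'\<close> solve the real-linear
      equation \<open>u' = cnj (A * u)\<close> and agree at 0.\<close>
    have "h x - t *\<^sub>R e' x = 0" for x
    proof (rule gronwall_vanish[where u = "\<lambda>x. h x - t *\<^sub>R e' x"
        and u' = "\<lambda>x. cnj (A x * h x) - t *\<^sub>R cnj (A x * e' x)" and K = K and ?x0.0 = 0])
      show "((\<lambda>x. h x - t *\<^sub>R e' x) has_vector_derivative
         cnj (A x * h x) - t *\<^sub>R cnj (A x * e' x)) (at x)" for x
        by (rule has_vector_derivative_diff[OF dh
          bounded_linear.has_vector_derivative[OF bounded_linear_scaleR_right de']])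
      show "norm (cnj (A x * h x) - t *\<^sub>R cnj (A x * e' x)) \<le> K * norm (h x - t *\<^sub>R e' x)" for x
      proof -
        have "cnj (A x * h x) - t *\<^sub>R cnj (A x * e' x) = cnj (A x * (h x - t *\<^sub>R e' x))"
          by (simp add: scaleR_conv_of_real algebra_simps)
        also have "norm \<dots> = norm (A x) * norm (h x - t *\<^sub>R e' x)"
          by (simp only: complex_mod_cnj norm_mult)
        also have "\<dots> \<le> K * norm (h x - t *\<^sub>R e' x)" by (intro mult_right_mono K) auto
        finally show ?thesis .
      qed
    qed (simp add: h0)
    then show ?thesis by (intro exI[of _ t]) (auto simp: fun_eq_iff)
  qed

  have nonneg: "(LINT x|lborel. (- h2 x + hess W (e x) (h x)) \<bullet> h x) \<ge> 0" if "H2_with h h1 h2" for h h1 h2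
    unfolding hessW integral_linearized_operator(2)[OF dA cA' bA bA' that]
    by (rule Bochner_Integration.integral_nonneg) simp
  have ker: "kerL W e = {(\<lambda>x. c *\<^sub>R e' x) | c. True}"
    using ker_sub e'_ker by blast
  moreover have "e' \<in> kerL W e" using e'_ker[of 1] by simp
  moreover have "e' \<noteq> (\<lambda>x. 0)" using e'_nz by auto
  ultimately show ?thesis using nonneg by blast
qed

end
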